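(* Let $k,n$ be positive integers with $n\ge \frac{(k+4)(k-1)}{2}+1$. Then there exists a ucycle of the set of all onto functions $f:[n]\to[k]$ for which the preimage cardinality function is strictly increasing, i.e. $|f^{-1}(\{1\})|<|f^{-1}(\{2\})|<\cdots<|f^{-1}(\{k\})|$.
   Context: $[m]=\{1,2,\dots,m\}$. A function $f:[n]\to[k]$ is identified with the string $f(1)f(2)\cdots f(n)$ of length $n$ over the alphabet $[k]$. A ucycle (universal cycle) of a finite nonempty set $\mathcal F$ of strings of length $n$ over $[k]$ is a cyclic sequence $a_1a_2\cdots a_N$ of elements of $[k]$, with $N=|\mathcal F|$ and indices taken modulo $N$, such that the $N$ windows $a_ia_{i+1}\cdots a_{i+n-1}$ ($1\le i\le N$) are exactly the elements of $\mathcal F$, each occurring exactly once. *)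

theory Defs
  imports Complex_Main "HOL-Library.FuncSet"
begin

(* Functions [n] -> [k] are extensional (undefined outside [n]), so that they correspond
   one-to-one to the strings f(1) f(2) ... f(n). *)

definition string_of :: "nat \<Rightarrow> (nat \<Rightarrow> nat) \<Rightarrow> nat list" where
  "string_of n f = map f [1..<Suc n]"

definition strings :: "nat \<Rightarrow> nat \<Rightarrow> nat list set" where
  "strings n k = {w. length w = n \<and> set w \<subseteq> {1..k}}"

(* List positions start at 0. The cyclic sequence may be shorter than the window. *)

definition window :: "nat \<Rightarrow> nat list \<Rightarrow> nat \<Rightarrow> nat list" where
  "window n a i = map (\<lambda>j. a ! ((i + j) mod length a)) [0..<n]"

definition is_ucycle :: "nat \<Rightarrow> nat \<Rightarrow> nat list set \<Rightarrow> nat list \<Rightarrow> bool" where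
  "is_ucycle n k F a \<longleftrightarrow>
     finite F \<and> F \<noteq> {} \<and> F \<subseteq> strings n k \<and>
     set a \<subseteq> {1..k} \<and> length a = card F \<and>
     bij_betw (window n a) {..<length a} F"

definition preimage_card :: "nat \<Rightarrow> (nat \<Rightarrow> nat) \<Rightarrow> nat \<Rightarrow> nat" where
  "preimage_card n f j = card (f -` {j} \<inter> {1..n})"

definition increasing_onto :: "nat \<Rightarrow> nat \<Rightarrow> (nat \<Rightarrow> nat) set" where
  "increasing_onto n k =
     {f \<in> {1..n} \<rightarrow>\<^sub>E {1..k}.
        f ` {1..n} = {1..k} \<and> strict_mono_on {1..k} (preimage_card n f)}"

end

theory Submission
  imports Defs "HOL-Library.Multiset" "Graph_Theory.Euler"
begin

text \<open>
  Ucycles are closed Euler trails in the digraph whose arcs are the words of the family \<open>F\<close>, from the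
  prefix \<open>butlast w\<close> to the suffix \<open>tl w\<close>. As \<open>F\<close> is closed under rotation, this digraph is balanced, so
  it only has to be connected: any two words must be joined by rotations and changes of a last
  letter, hence by changes of single letters inside \<open>F\<close>.

  A letter \<open>i < k\<close> whose count exceeds that of \<open>i - 1\<close> by more than one can be replaced by \<open>k\<close>. Repeating
  this leads to counts \<open>1, 2, \<dots>, k - 1, m\<close>, and the bound on \<open>n\<close> says exactly that \<open>m \<ge> 2k - 1\<close>. This
  slack suffices to turn, one after the other, one \<open>k\<close> into each of \<open>k - 1, \<dots>, i + 1\<close>, and then a \<open>k\<close> into
  an \<open>i\<close> and another \<open>i\<close> into a \<open>k\<close>, provided that \<open>i \<ge> 2\<close>. Undoing the first changes leaves an \<open>i\<close> and a \<open>k\<close>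
  exchanged, and such exchanges generate all permutations that fix the single letter \<open>1\<close>. That letter
  is brought into place by a rotation.
\<close>

section \<open>Connectedness and balance of the de Bruijn digraph\<close>

text \<open>Weak connectivity expressed on arcs: \<open>rot\<close> moves along \<open>w\<close>
  from its tail to its head, \<open>last\<close> changes the arc that leaves a fixed vertex.
  Reflexivity on \<open>F\<close> is an instance of \<open>last\<close>.\<close>

inductive linked :: "'a list set \<Rightarrow> 'a list \<Rightarrow> 'a list \<Rightarrow> bool" for F where
  rot: "w \<in> F \<Longrightarrow> linked F w (rotate1 w)"
| last: "v \<in> F \<Longrightarrow> w \<in> F \<Longrightarrow> butlast v = butlast w \<Longrightarrow> linked F v w"
| sym: "linked F v w \<Longrightarrow> linked F w v"
| trans: "linked F u v \<Longrightarrow> linked F v w \<Longrightarrow> linked F u w"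

lemma linked_refl: "w \<in> F \<Longrightarrow> linked F w w"
  by (rule linked.last) auto

text \<open>Prefixes suffice as vertices: if \<open>F\<close> is closed under rotation, the suffix
  of \<open>w\<close> is the prefix of \<open>rotate1 w\<close>.\<close>

definition debruijn :: "'a list set \<Rightarrow> ('a list, 'a list) pre_digraph" where
  "debruijn F = \<lparr>verts = butlast ` F, arcs = F, tail = butlast, head = tl\<rparr>"

lemma debruijn_simps [simp]:
  "verts (debruijn F) = butlast ` F" "arcs (debruijn F) = F"
  "tail (debruijn F) = butlast" "head (debruijn F) = tl"
  by (simp_all add: debruijn_def)

lemma butlast_rotate1: "butlast (rotate1 w) = tl w"
  by (cases w) auto

lemma fin_digraph_debruijn:
  assumes "finite F" and "\<And>w. w \<in> F \<Longrightarrow> rotate1 w \<in> F"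
  shows "fin_digraph (debruijn F)"
proof
  fix e assume "e \<in> arcs (debruijn F)"
  then show "head (debruijn F) e \<in> verts (debruijn F)"
    using assms(2)[of e] by (auto simp flip: butlast_rotate1)
qed (use assms in auto)

text \<open>Rotation maps the arcs entering \<open>u\<close> bijectively to the arcs leaving
  \<open>u\<close>. It is onto because an injective self-map of a finite set is.\<close>

lemma degree_debruijn:
  assumes "finite F" and "\<And>w. w \<in> F \<Longrightarrow> rotate1 w \<in> F"
  shows "in_degree (debruijn F) u = out_degree (debruijn F) u"
proof -
  have inj: "inj_on rotate1 F"
    by (rule inj_on_subset[OF inj_rotate1 subset_UNIV])
  have surj: "rotate1 ` F = F"
    using assms by (intro card_subset_eq) (auto simp: card_image[OF inj])
  have "bij_betw rotate1 {w \<in> F. tl w = u} {w \<in> F. butlast w = u}"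
    unfolding bij_betw_def
  proof
    show "inj_on rotate1 {w \<in> F. tl w = u}"
      using inj by (rule inj_on_subset) auto
    have "{w \<in> F. butlast w = u} = {w \<in> rotate1 ` F. butlast w = u}"
      by (simp only: surj)
    also have "\<dots> = rotate1 ` {w \<in> F. tl w = u}"
      by (auto simp: butlast_rotate1)
    finally show "rotate1 ` {w \<in> F. tl w = u} = {w \<in> F. butlast w = u}" ..
  qed
  then show ?thesis
    by (auto simp: in_degree_def out_degree_def in_arcs_def out_arcs_def dest: bij_betw_same_card)
qed

lemma connected_debruijn:
  assumes "finite F" and rot: "\<And>w. w \<in> F \<Longrightarrow> rotate1 w \<in> F" and "F \<noteq> {}"
    and linked: "\<And>v w. v \<in> F \<Longrightarrow> w \<in> F \<Longrightarrow> linked F v w"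
  shows "connected (debruijn F)"
proof -
  interpret fin_digraph "debruijn F"
    using assms by (intro fin_digraph_debruijn)
  interpret S: pair_fin_digraph "mk_symmetric (debruijn F)" ..
  have reach: "butlast v \<rightarrow>\<^sup>*\<^bsub>mk_symmetric (debruijn F)\<^esub> butlast w" if "linked F v w" for v w
    using that
  proof induction
    case (rot w)
    then have "butlast w \<rightarrow>\<^bsub>debruijn F\<^esub> tl w"
      using in_arcs_imp_in_arcs_ends[of w] by simp
    then show ?case
      by (simp add: butlast_rotate1 reachable_mk_symmetricI)
  next
    case (last v w)
    then show ?case
      by (intro reachable_mk_symmetricI) simp
  next
    case (sym v w)
    from symmetric_mk_symmetric sym.IH show ?case
      by (rule symmetric_reachable)
  next
    case (trans u v w)
    from trans.IH show ?case
      by (rule S.reachable_trans)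
  qed
  show ?thesis
    unfolding connected_def strongly_connected_def
  proof (intro conjI ballI)
    fix x y assume "x \<in> verts (mk_symmetric (debruijn F))" "y \<in> verts (mk_symmetric (debruijn F))"
    then obtain v w where "v \<in> F" "w \<in> F" "x = butlast v" "y = butlast w"
      by auto
    then show "x \<rightarrow>\<^sup>*\<^bsub>mk_symmetric (debruijn F)\<^esub> y"
      using reach[OF linked] by simp
  qed (use \<open>F \<noteq> {}\<close> in simp)
qed

section \<open>From closed Euler trails to universal cycles\<close>

lemma (in pre_digraph) cas_nth:
  assumes "cas u p v" "Suc i < length p"
  shows "head G (p ! i) = tail G (p ! Suc i)"
  using assms
proof (induction p arbitrary: u i)
  case (Cons e p)
  then show ?case
    by (cases i; cases p) auto
qed simp

lemma (in pre_digraph) cas_last_hd: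
  assumes "cas u p v" "p \<noteq> []"
  shows "head G (List.last p) = v" "tail G (hd p) = u"
proof -
  show "head G (List.last p) = v"
    using assms
  proof (induction p arbitrary: u)
    case (Cons e p)
    then show ?case
      by (cases p) auto
  qed simp
  show "tail G (hd p) = u"
    using assms by (cases p) auto
qed

text \<open>By the overlap, letter \<open>j + 1\<close> of a word is letter \<open>j\<close> of the
  next one, so \<open>j\<close> steps lead to a first letter. Hence the first letters along a closed
  trail form a cyclic sequence whose windows are the arcs. Indices wrap around, so \<open>n\<close>
  may exceed \<open>length p\<close>.\<close>

lemma cyclic_overlap_nth:
  assumes len: "\<And>w. w \<in> set p \<Longrightarrow> length w = n"
    and step: "\<And>i. i < length p \<Longrightarrow> tl (p ! i) = butlast (p ! (Suc i mod length p))"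
    and "i < length p" "j < n"
  shows "p ! i ! j = hd (p ! ((i + j) mod length p))"
  using assms(3,4)
proof (induction j arbitrary: i)
  case 0
  then have "p ! i \<noteq> []"
    using len[OF nth_mem[OF 0(1)]] by auto
  then show ?case
    using 0 by (simp add: hd_conv_nth)
next
  case (Suc j)
  let ?i = "Suc i mod length p"
  have i: "?i < length p"
    using Suc.prems by (intro mod_less_divisor) auto
  have "length (p ! i) = n" "length (p ! ?i) = n"
    using len Suc.prems i by auto
  then have "p ! i ! Suc j = p ! ?i ! j"
    using step[OF Suc.prems(1)] Suc.prems(2)
    by (metis One_nat_def length_tl less_diff_conv nth_butlast nth_tl Suc_eq_plus1)
  also have "\<dots> = hd (p ! ((?i + j) mod length p))"
    using Suc.prems by (intro Suc.IH i) auto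
  also have "(?i + j) mod length p = (i + Suc j) mod length p"
    by (simp add: mod_add_left_eq)
  finally show ?case .
qed

theorem ucycle_if_linked:
  assumes F: "F \<subseteq> strings n k" "F \<noteq> {}" and "n \<ge> 1"
    and rot: "\<And>w. w \<in> F \<Longrightarrow> rotate1 w \<in> F"
    and linked: "\<And>v w. v \<in> F \<Longrightarrow> w \<in> F \<Longrightarrow> linked F v w"
  shows "\<exists>a. is_ucycle n k F a"
proof -
  have "finite (strings n k)"
    using finite_lists_length_eq[of "{1..k}" n] by (simp add: strings_def conj_commute)
  then have fin: "finite F"
    using F finite_subset by blast
  interpret fin_digraph "debruijn F"
    using fin rot by (rule fin_digraph_debruijn)
  obtain u p where "euler_trail u p u"
    using closed_euler1 connected_debruijn[OF fin rot F(2) linked] degree_debruijn[OF fin rot]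
    by blast
  then have p: "cas u p u" "distinct p" "set p = F"
    by (auto simp: euler_trail_def trail_def awalk_def)
  have ne: "p \<noteq> []"
    using p F by auto
  have step: "tl (p ! i) = butlast (p ! (Suc i mod length p))" if "i < length p" for i
  proof (cases "Suc i < length p")
    case True
    then show ?thesis
      using cas_nth[OF p(1) True] by simp
  next
    \<comment> \<open>At the last arc, closedness of the trail makes its head the tail of the first
      arc.\<close>
    case False
    then have "i = length p - 1" "Suc i = length p"
      using that by auto
    then show ?thesis
      using cas_last_hd[OF p(1) ne] ne by (auto simp: last_conv_nth hd_conv_nth)
  qed
  have len: "length w = n" "set w \<subseteq> {1..k}" if "w \<in> set p" for w
    using that F p by (auto simp: strings_def)
  have win: "window n (map hd p) i = p ! i" if i: "i < length p" for i
  proof (rule nth_equalityI)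
    show "length (window n (map hd p) i) = length (p ! i)"
      using i len by (simp add: window_def)
    fix j assume "j < length (window n (map hd p) i)"
    then have j: "j < n"
      by (simp add: window_def)
    have "(i + j) mod length p < length p"
      using ne by simp
    then show "window n (map hd p) i ! j = p ! i ! j"
      using cyclic_overlap_nth[of p n i j] len step i j by (simp add: window_def)
  qed
  have "bij_betw ((!) p) {..<length p} F"
    using p by (intro bij_betw_nth) auto
  then have "bij_betw (window n (map hd p)) {..<length p} F"
    by (rule bij_betw_cong[THEN iffD1, rotated]) (simp add: win)
  moreover have "hd w \<in> {1..k}" if "w \<in> set p" for w
    using len[OF that] \<open>n \<ge> 1\<close> by (cases w) auto
  ultimately have "is_ucycle n k F (map hd p)"
    using F fin p distinct_card[OF p(2)] by (auto simp: is_ucycle_def)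
  then show ?thesis ..
qed

section \<open>Rotations and single-letter changes\<close>

lemma linked_rotate:
  assumes rot: "\<And>w. w \<in> F \<Longrightarrow> rotate1 w \<in> F" and "w \<in> F"
  shows "rotate m w \<in> F \<and> linked F w (rotate m w)"
proof (induction m)
  case 0
  then show ?case
    using assms by (simp add: linked_refl)
next
  case (Suc m)
  then show ?case
    by (auto intro: rot linked.intros)
qed

text \<open>Rotating by \<open>Suc p\<close> brings position \<open>p\<close> to the end, where the
  rule \<open>last\<close> can change it; then one rotates back.\<close>

lemma linked_list_update:
  assumes rot: "\<And>w. w \<in> F \<Longrightarrow> rotate1 w \<in> F" and w: "w \<in> F" "w[p := b] \<in> F"
  shows "linked F w (w[p := b])"
proof (cases "p < length w")
  case True
  let ?R = "rotate (Suc p)"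
  have R: "?R v = drop (Suc p) v @ take (Suc p) v" if "length v = length w" for v :: "'a list"
    using True that by (cases "Suc p = length w") (auto simp: rotate_drop_take)
  have "butlast (?R w) = butlast (?R (w[p := b]))"
    using True by (simp add: R take_Suc_conv_app_nth butlast_append del: rotate_Suc)
  then have "linked F (?R w) (?R (w[p := b]))"
    using linked_rotate[OF rot, of _ "Suc p"] w by (intro linked.last) (auto simp del: rotate_Suc)
  then show ?thesis
    using linked_rotate[OF rot w(1), of "Suc p"] linked_rotate[OF rot w(2), of "Suc p"]
    by (meson linked.sym linked.trans)
next
  case False
  then show ?thesis
    using w by (simp add: linked_refl list_update_beyond)
qed

section \<open>Words with increasing letter counts\<close>

text \<open>As \<open>0\<close> is not an element of \<open>M\<close>, the case \<open>j = 0\<close> says that \<open>1\<close> is one.\<close>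

definition increasing :: "nat \<Rightarrow> nat multiset \<Rightarrow> bool" where
  "increasing k M \<longleftrightarrow> set_mset M \<subseteq> {1..k} \<and> (\<forall>j<k. count M j < count M (Suc j))"

definition increasing_words :: "nat \<Rightarrow> nat \<Rightarrow> nat list set" where
  "increasing_words n k = {w. length w = n \<and> increasing k (mset w)}"

text \<open>The counts after one \<open>k\<close> has been turned into each of \<open>k - 1, \<dots>, j\<close>. The bound on the count of \<open>k\<close>
  is \<open>2k - 1\<close> less the \<open>k - j\<close> letters given away.\<close>

definition staircase :: "nat \<Rightarrow> nat \<Rightarrow> nat multiset \<Rightarrow> bool" where
  "staircase k j M \<longleftrightarrow> set_mset M \<subseteq> {1..k} \<and> (\<forall>i<j. count M i = i) \<and>
     (\<forall>i. j \<le> i \<and> i < k \<longrightarrow> count M i = Suc i) \<and> k + j \<le> Suc (count M k)"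

lemma mset_rotate1: "mset (rotate1 w) = mset w"
  by (cases w) auto

lemma mset_rotate: "mset (rotate m w) = mset w"
  by (induction m) (auto simp: mset_rotate1)

lemma rotate1_increasing_words: "w \<in> increasing_words n k \<Longrightarrow> rotate1 w \<in> increasing_words n k"
  by (simp add: increasing_words_def mset_rotate1)

lemma length_increasing_words: "w \<in> increasing_words n k \<Longrightarrow> length w = n"
  by (simp add: increasing_words_def)

lemma count_mset_update:
  assumes "p < length w"
  shows "count (mset (w[p := b])) x =
    (if x = b then 1 else 0) + (count (mset w) x - (if x = w ! p then 1 else 0))"
  using assms by (auto simp: mset_update)

lemma mset_update_swap:
  assumes "p < length w" "q < length w"
  shows "mset (w[p := w ! q, q := w ! p]) = mset w"
  using assms mset_swap[of q w p] by simp

lemma count_mset_eq_card: "count (mset w) a = card {i. i < length w \<and> w ! i = a}"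
  unfolding count_mset count_list_eq_length_filter length_filter_conv_card
  by (rule arg_cong[where f = card]) auto

lemma ex_nth_eq:
  assumes "2 \<le> count (mset w) a"
  obtains r where "r < length w" "r \<noteq> q" "w ! r = a"
proof (rule ccontr)
  assume "\<not> thesis"
  then have "{i. i < length w \<and> w ! i = a} \<subseteq> {q}"
    using that by blast
  then have "count (mset w) a \<le> 1"
    using card_mono[of "{q}"] by (simp add: count_mset_eq_card del: count_mset)
  with assms show False
    by linarith
qed

text \<open>The critical comparison is at the top: for \<open>j < k\<close> the letter
  \<open>k - 1\<close> occurs \<open>k\<close> times and \<open>k\<close> is only known to occur
  \<open>k + j - 1\<close> times, which is more only if \<open>2 \<le> j\<close>. This is why the
  letter \<open>1\<close> is kept out of all exchanges.\<close>

lemma staircase_imp_increasing: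
  assumes "staircase k j M" "1 \<le> j" "j \<le> k" "2 \<le> j \<or> j = k"
  shows "increasing k M"
  unfolding increasing_def
proof (intro conjI allI impI)
  show "set_mset M \<subseteq> {1..k}"
    using assms by (simp add: staircase_def)
  fix i assume "i < k"
  have M: "count M x = (if x < j then x else Suc x)" if "x < k" for x
    using assms that by (simp add: staircase_def)
  have "k + j \<le> Suc (count M k)"
    using assms by (simp add: staircase_def)
  then show "count M i < count M (Suc i)"
    using M[of i] M[of "Suc i"] \<open>i < k\<close> assms(2-) by (cases "Suc i = k") (auto split: if_splits)
qed

text \<open>One \<open>k\<close> is lost, and the lower bound on its count drops by one as
  well.\<close>

lemma staircase_update:
  assumes "staircase k (Suc j) (mset w)" "1 \<le> j" "j < k" "r < length w" "w ! r = k"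
  shows "staircase k j (mset (w[r := j]))"
  using assms set_update_subsetI[of w "{1..k}" j r]
  by (auto simp: staircase_def count_mset_update simp del: count_mset)

section \<open>Exchanging two letters\<close>

lemma linked_update:
  assumes "w \<in> increasing_words n k" "w[p := b] \<in> increasing_words n k"
  shows "linked (increasing_words n k) w (w[p := b])"
  using rotate1_increasing_words assms by (rule linked_list_update)

text \<open>The induction goes up from \<open>j = Suc i\<close>, where the letters strictly between
  \<open>i\<close> and \<open>k\<close> have all been raised, so that there is room for one more
  \<open>i\<close>.\<close>

lemma linked_swap_top:
  assumes "staircase k j (mset w)" "2 \<le> i" "i < j" "j \<le> k"
    and "length w = n" "p < n" "q < n" "w ! p = i" "w ! q = k"
  shows "linked (increasing_words n k) w (w[p := k, q := i])"
proof -
  let ?L = "linked (increasing_words n k)"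
  have "Suc i \<le> j"
    using assms by simp
  then show ?thesis
    using assms
  proof (induction j arbitrary: w rule: dec_induct)
    case base
    have mem: "w \<in> increasing_words n k" "w[p := k, q := i] \<in> increasing_words n k"
      using base mset_update_swap[of p w q] staircase_imp_increasing[of k "Suc i" "mset w"]
      by (auto simp: increasing_words_def)
    \<comment> \<open>Turning the \<open>k\<close> at \<open>q\<close> into \<open>i\<close> keeps
      the counts increasing because \<open>2 \<le> i\<close>; afterwards the old \<open>i\<close> at
      \<open>p\<close> becomes \<open>k\<close>.\<close>
    have "staircase k i (mset (w[q := i]))"
      using base by (intro staircase_update) auto
    then have mem': "w[q := i] \<in> increasing_words n k"
      using base staircase_imp_increasing by (auto simp: increasing_words_def)
    have "w[p := k, q := i] = w[q := i, p := k]"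
      using base by (intro list_update_swap) auto
    then show ?case
      using linked_update[OF mem(1) mem'] linked_update[OF mem', of p k] mem(2)
      by (metis linked.trans)
  next
    case (step j)
    have mem: "w \<in> increasing_words n k" "w[p := k, q := i] \<in> increasing_words n k"
      using step.prems step.hyps mset_update_swap[of p w q] staircase_imp_increasing[of k "Suc j" "mset w"]
      by (auto simp: increasing_words_def)
    \<comment> \<open>A second \<open>k\<close> is needed, since the one at \<open>q\<close> is to
      be exchanged. It becomes \<open>j\<close> for the duration of the exchange and is restored
      afterwards.\<close>
    have "2 \<le> count (mset w) k"
      using step.prems by (simp add: staircase_def del: count_mset)
    then obtain r where r: "r < length w" "r \<noteq> q" "w ! r = k"
      by (rule ex_nth_eq)
    have "r \<noteq> p"
      using r step by auto
    let ?w = "w[r := j]"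
    have st: "staircase k j (mset ?w)"
      using step r by (intro staircase_update) auto
    have L: "?L ?w (?w[p := k, q := i])"
      using step.prems step.hyps r \<open>r \<noteq> p\<close> st by (intro step.IH) auto
    have mem': "?w \<in> increasing_words n k" "?w[p := k, q := i] \<in> increasing_words n k"
      using step.prems step.hyps r \<open>r \<noteq> p\<close> st mset_update_swap[of p ?w q]
        staircase_imp_increasing[of k j "mset ?w"]
      by (auto simp: increasing_words_def)
    have "?w[p := k, q := i] = w[p := k, q := i, r := j]"
      using r \<open>r \<noteq> p\<close> by (metis list_update_swap)
    then have "?L (w[p := k, q := i]) (?w[p := k, q := i])"
      using linked_update[OF mem(2), of r j] mem' by simp
    with L linked_update[OF mem(1) mem'(1)] show ?case
      by (meson linked.sym linked.trans)
  qed
qed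

text \<open>If neither letter is \<open>k\<close>, the transposition is a product of three
  transpositions through a third position, each of which moves a \<open>k\<close>.\<close>

lemma linked_swap:
  assumes st: "staircase k k (mset w)" and len: "length w = n" and "2 \<le> k"
    and pq: "p < n" "q < n" "2 \<le> w ! p" "2 \<le> w ! q"
  shows "linked (increasing_words n k) w (w[p := w ! q, q := w ! p])"
proof -
  let ?L = "linked (increasing_words n k)"
  have top: "?L v (v[p := v ! q, q := v ! p])"
    if v: "staircase k k (mset v)" "length v = n"
      and pq: "p < n" "q < n" "2 \<le> v ! p" "2 \<le> v ! q" and k: "v ! p = k \<or> v ! q = k" for v p q
  proof -
    have mem: "v \<in> increasing_words n k"
      using v \<open>2 \<le> k\<close> staircase_imp_increasing[of k k "mset v"] by (auto simp: increasing_words_def)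
    have "v ! p \<in> set v" "v ! q \<in> set v"
      using v pq by auto
    then have le: "v ! p \<le> k" "v ! q \<le> k"
      using v unfolding staircase_def by auto
    consider "v ! p = v ! q" | "v ! q = k" "v ! p < k" | "v ! p = k" "v ! q < k"
      using k le by linarith
    then show ?thesis
    proof cases
      case 1
      then show ?thesis
        using mem by (metis linked_refl list_update_id)
    next
      case 2
      then show ?thesis
        using linked_swap_top[of k k v "v ! p" n p q] v pq by simp
    next
      case 3
      then have "p \<noteq> q"
        by auto
      then show ?thesis
        using 3 linked_swap_top[of k k v "v ! q" n q p] v pq by (simp add: list_update_swap)
    qed
  qed
  show ?thesis
  proof (cases "w ! p = k \<or> w ! q = k \<or> p = q")
    case True
    then show ?thesis
      using top[of w p q] st len pq \<open>2 \<le> k\<close> staircase_imp_increasing[of k k "mset w"]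
      by (auto simp: increasing_words_def linked_refl)
  next
    case False
    have "2 \<le> count (mset w) k"
      using st \<open>2 \<le> k\<close> by (simp add: staircase_def del: count_mset)
    then obtain r where r: "r < n" "r \<noteq> p" "w ! r = k"
      using ex_nth_eq[of w k p] len by auto
    then have "r \<noteq> q"
      using False by auto
    \<comment> \<open>From letters \<open>a\<close>, \<open>b\<close>, \<open>k\<close> at
      \<open>p\<close>, \<open>q\<close>, \<open>r\<close>, the exchanges lead through
      \<open>k\<close>, \<open>b\<close>, \<open>a\<close> and \<open>b\<close>, \<open>k\<close>,
      \<open>a\<close> to \<open>b\<close>, \<open>a\<close>, \<open>k\<close>.\<close>
    let ?u = "w[p := k, r := w ! p]"
    let ?v = "?u[p := w ! q, q := k]"
    have "mset ?u = mset w"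
      using mset_update_swap[of p w r] r pq len by simp
    moreover have "mset ?v = mset ?u"
      using mset_update_swap[of p ?u q] r pq len False \<open>r \<noteq> q\<close> by (simp add: nth_list_update)
    moreover have "?L w ?u"
      using top[of w p r] st len pq r \<open>2 \<le> k\<close> by simp
    moreover have "?L ?u ?v" if "mset ?u = mset w"
      using top[of ?u p q] st len pq r \<open>2 \<le> k\<close> that False \<open>r \<noteq> q\<close>
      by (simp add: nth_list_update)
    moreover have "?L ?v (?v[q := w ! p, r := k])" if "mset ?v = mset w"
      using top[of ?v q r] st len pq r \<open>2 \<le> k\<close> that False \<open>r \<noteq> q\<close>
      by (simp add: nth_list_update)
    moreover have "?v[q := w ! p, r := k] = w[p := w ! q, q := w ! p]"
      using r False \<open>r \<noteq> q\<close> len pq by (auto intro!: nth_equalityI simp: nth_list_update)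
    ultimately show ?thesis
      by (metis linked.trans)
  qed
qed

section \<open>Reduction to staircase counts\<close>

text \<open>The letters below \<open>k\<close> contribute \<open>0 + 1 + ... + (k - 1)\<close>.
  Doubling, with \<open>k\<close> on the left, avoids division and subtraction.\<close>

lemma count_top:
  assumes "set_mset M \<subseteq> {1..k}" "\<forall>i<k. count M i = i"
  shows "2 * size M + k = k * k + 2 * count M k"
proof -
  have "size M = sum (count M) (set_mset M)"
    by (simp add: size_multiset_overloaded_eq)
  also have "\<dots> = sum (count M) {..k}"
    using assms(1) by (intro sum.mono_neutral_left) (auto simp: count_eq_zero_iff)
  also have "\<dots> = (\<Sum>i<k. i) + count M k"
    using assms(2) by (simp add: lessThan_Suc_atMost[symmetric])
  finally have "size M = (\<Sum>i<k. i) + count M k" .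
  moreover have "2 * (\<Sum>i<k. i) + k = k * k"
    by (induction k) auto
  ultimately show ?thesis
    by simp
qed

lemma staircase_unique:
  assumes "staircase k k M" "staircase k k N" "size M = size N"
  shows "M = N"
proof (rule multiset_eqI)
  fix x
  have "count M k = count N k"
    using assms count_top[of M k] count_top[of N k] by (simp add: staircase_def)
  moreover have "count M x = 0 \<and> count N x = 0" if "x > k"
    using assms that by (auto simp: staircase_def count_eq_zero_iff)
  ultimately show "count M x = count N x"
    using assms by (cases x k rule: linorder_cases) (auto simp: staircase_def)
qed

text \<open>The gap below the letter \<open>w ! p\<close> absorbs its loss; every other comparison
  is kept or relaxed.\<close>

lemma increasing_move_to_top:
  assumes "increasing k (mset w)" "p < length w" "w ! p < k"
    and "Suc (count (mset w) (w ! p - 1)) < count (mset w) (w ! p)"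
  shows "increasing k (mset (w[p := k]))"
proof -
  have "set (w[p := k]) \<subseteq> {1..k}"
    using assms set_update_subsetI[of w "{1..k}" k p] by (auto simp: increasing_def)
  moreover have "count (mset (w[p := k])) j < count (mset (w[p := k])) (Suc j)" if "j < k" for j
  proof -
    have "count (mset w) j < count (mset w) (Suc j)"
      using assms that by (simp add: increasing_def del: count_mset)
    then show ?thesis
      using assms(2-) that
      by (cases "w ! p = Suc j") (auto simp: count_mset_update simp del: count_mset)
  qed
  ultimately show ?thesis
    by (simp add: increasing_def del: count_mset)
qed

lemma linked_staircase:
  assumes "1 \<le> k" "k * (k + 3) \<le> 2 * n + 2" "w \<in> increasing_words n k"
  shows "\<exists>v. linked (increasing_words n k) w v \<and> length v = n \<and> staircase k k (mset v)"
  using assms(3)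
proof (induction "n - count (mset w) k" arbitrary: w rule: less_induct)
  case less
  have w: "increasing k (mset w)" "length w = n"
    using less.prems by (auto simp: increasing_words_def)
  then have sub: "set_mset (mset w) \<subseteq> {1..k}"
    by (simp add: increasing_def)
  show ?case
  proof (cases "\<forall>i<k. count (mset w) i = i")
    case True
    \<comment> \<open>With \<open>count_top\<close>, the bound on \<open>n\<close> becomes
      \<open>2k - 1\<close> as a lower bound on the count of \<open>k\<close>.\<close>
    then have "staircase k k (mset w)"
      using count_top[OF sub True] assms(2) w sub
      by (simp add: staircase_def algebra_simps del: count_mset)
    then show ?thesis
      using less.prems w linked_refl by blast
  next
    case False
    \<comment> \<open>The least failing letter has a gap below it: its predecessor occurs exactly
      \<open>i - 1\<close> times, while \<open>i\<close> occurs more often than that but not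
      \<open>i\<close> times.\<close>
    define i where "i = (LEAST i. i < k \<and> count (mset w) i \<noteq> i)"
    have i: "i < k" "count (mset w) i \<noteq> i"
      using LeastI_ex[of "\<lambda>i. i < k \<and> count (mset w) i \<noteq> i"] False unfolding i_def by blast+
    have below: "count (mset w) j = j" if "j < i" for j
      using not_less_Least[of j "\<lambda>i. i < k \<and> count (mset w) i \<noteq> i"] that i(1)
      unfolding i_def[symmetric] by auto
    have "0 \<notin> set w"
      using sub by auto
    then have "i \<noteq> 0"
      using i by (intro notI) (simp add: count_list_0_iff)
    then obtain i' where i': "i = Suc i'"
      by (cases i) auto
    have "count (mset w) i' = i'"
      using below i' by blast
    moreover have "count (mset w) i' < count (mset w) i"
      using w i i' by (simp add: increasing_def del: count_mset)
    ultimately have gap: "Suc (count (mset w) i') < count (mset w) i"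
      using i i' by linarith
    then have "i \<in># mset w"
      by (intro count_inI) linarith
    then obtain p where p: "p < length w" "w ! p = i"
      by (auto simp: in_set_conv_nth)
    have mem: "w[p := k] \<in> increasing_words n k"
      using increasing_move_to_top[OF w(1) p(1)] gap i i' p w
      by (auto simp: increasing_words_def)
    \<comment> \<open>Position \<open>p\<close> does not hold \<open>k\<close>, so the count of
      \<open>k\<close> is below \<open>n\<close> and the truncated difference really drops.\<close>
    have "k \<noteq> w ! p"
      using p i by simp
    then have "count (mset w) k < n"
      using p w count_le_length[of "w[p := k]" k] by (simp add: count_mset_update flip: count_mset)
    then have "n - count (mset (w[p := k])) k < n - count (mset w) k"
      using p i by (simp add: count_mset_update del: count_mset)
    then show ?thesis
      using less.hyps[OF _ mem] linked_update[OF less.prems mem] linked.trans by blast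
  qed
qed

section \<open>Linking any two words\<close>

text \<open>Each exchange corrects one disagreeing position and spoils no agreeing one, so the
  number of disagreements decreases.\<close>

lemma linked_if_same_ones:
  assumes "2 \<le> k" "staircase k k (mset v)" "length v = n" "mset v = mset w"
    and "\<And>p. p < n \<Longrightarrow> v ! p = 1 \<longleftrightarrow> w ! p = 1"
  shows "linked (increasing_words n k) v w"
  using assms
proof (induction "card {p. p < n \<and> v ! p \<noteq> w ! p}" arbitrary: v rule: less_induct)
  case less
  note k = less.prems(1) and st = less.prems(2) and len = less.prems(3)
    and perm = less.prems(4) and ones = less.prems(5)
  have len': "length w = n"
    using len perm by (metis size_mset)
  have ge: "1 \<le> x" if "x \<in> set v \<or> x \<in> set w" for x
    using st that perm unfolding staircase_def by (metis atLeastAtMost_iff set_mset_mset subsetD)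
  show ?case
  proof (cases "v = w")
    case True
    then show ?thesis
      using st len staircase_imp_increasing[OF st] k
      by (auto simp: increasing_words_def intro: linked_refl)
  next
    case False
    then obtain p where p: "p < n" "v ! p \<noteq> w ! p"
      using len len' by (metis nth_equalityI)
    let ?S = "\<lambda>u. {i. i < length u \<and> u ! i = w ! p}"
    have "card (?S v) = card (?S w)"
      using perm by (simp flip: count_mset_eq_card del: count_mset)
    moreover have "p \<in> ?S w" "p \<notin> ?S v"
      using p len' by auto
    \<comment> \<open>Both words contain \<open>w ! p\<close> equally often, but at \<open>p\<close>
      only \<open>w\<close> has it. So at some \<open>q\<close> only \<open>v\<close> has it, and
      \<open>q\<close> is a disagreement too.\<close>
    ultimately have "\<not> ?S v \<subseteq> ?S w"
      using card_subset_eq[of "?S w" "?S v"] by fastforce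
    then obtain q where q: "q < n" "v ! q = w ! p" "w ! q \<noteq> w ! p"
      using len len' by auto
    \<comment> \<open>The ones of \<open>v\<close> and \<open>w\<close> are at the same positions,
      so no disagreeing position holds a \<open>1\<close>.\<close>
    have "v ! p \<noteq> 1" "v ! q \<noteq> 1" "w ! p \<noteq> 1" "w ! q \<noteq> 1"
      using ones[OF p(1)] ones[OF q(1)] p q by auto
    moreover have "1 \<le> v ! i" if "i < n" for i
      using ge that len by simp
    note this[OF p(1)] this[OF q(1)]
    ultimately have ge2: "2 \<le> v ! p" "2 \<le> v ! q"
      by auto
    let ?v = "v[p := v ! q, q := v ! p]"
    have "p \<noteq> q"
      using p q by auto
    have nth: "?v ! i = (if i = p then w ! p else if i = q then v ! p else v ! i)" if "i < n" for i
      using that q len \<open>p \<noteq> q\<close> by (simp add: nth_list_update)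
    have perm': "mset ?v = mset v"
      using p q len by (intro mset_update_swap) auto
    have "{i. i < n \<and> ?v ! i \<noteq> w ! i} \<subset> {i. i < n \<and> v ! i \<noteq> w ! i}"
    proof
      show "{i. i < n \<and> ?v ! i \<noteq> w ! i} \<subseteq> {i. i < n \<and> v ! i \<noteq> w ! i}"
      proof clarify
        fix i assume "i < n" "?v ! i \<noteq> w ! i" "v ! i = w ! i"
        then show False
          using nth[of i] q by (auto split: if_splits)
      qed
      show "{i. i < n \<and> ?v ! i \<noteq> w ! i} \<noteq> {i. i < n \<and> v ! i \<noteq> w ! i}"
        using p nth[OF p(1)] by auto
    qed
    then have "card {i. i < n \<and> ?v ! i \<noteq> w ! i} < card {i. i < n \<and> v ! i \<noteq> w ! i}"
      by (intro psubset_card_mono) auto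
    then have "linked (increasing_words n k) ?v w"
    proof (rule less.hyps)
      show "?v ! i = 1 \<longleftrightarrow> w ! i = 1" if "i < n" for i
        using nth[OF that] ones[OF that] \<open>v ! p \<noteq> 1\<close> \<open>w ! p \<noteq> 1\<close> \<open>w ! q \<noteq> 1\<close> by auto
    qed (use k st len perm perm' in auto)
    with linked_swap[OF st len k p(1) q(1) ge2] show ?thesis
      by (rule linked.trans)
  qed
qed

text \<open>For \<open>2 \<le> k\<close> the letter \<open>1\<close> occurs only once, so one
  rotation fixes where it stands. Two words normalised in this way have the same ones.\<close>

lemma linked_leading_one:
  assumes "2 \<le> k" "staircase k k (mset v)" "length v = n"
  shows "\<exists>u. linked (increasing_words n k) v u \<and> mset u = mset v \<and> (\<forall>p<n. u ! p = 1 \<longleftrightarrow> p = 0)"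
proof -
  have c1: "count (mset v) 1 = 1"
    using assms by (simp add: staircase_def)
  then have "1 \<in> set v"
    using count_greater_zero_iff[of "mset v" 1] by simp
  then obtain p where p: "p < n" "v ! p = 1"
    using assms by (auto simp: in_set_conv_nth)
  let ?u = "rotate p v"
  have u: "length ?u = n" "mset ?u = mset v"
    using assms by (auto simp: mset_rotate)
  have u0: "?u ! 0 = 1"
    using p assms by (simp add: nth_rotate)
  have "card {i. i < n \<and> ?u ! i = 1} = 1"
    using c1 u count_mset_eq_card[of ?u 1] by simp
  then obtain r where r: "{i. i < n \<and> ?u ! i = 1} = {r}"
    by (rule card_1_singletonE)
  have "i = r" if "i < n" "?u ! i = 1" for i
    using r that by blast
  then have "\<forall>i<n. ?u ! i = 1 \<longleftrightarrow> i = 0"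
    using u0 p by (metis gr_zeroI not_less_zero)
  moreover have "v \<in> increasing_words n k"
    using assms staircase_imp_increasing[of k k "mset v"] by (auto simp: increasing_words_def)
  then have "linked (increasing_words n k) v ?u"
    using linked_rotate rotate1_increasing_words by blast
  ultimately show ?thesis
    using u by blast
qed

lemma linked_increasing_words:
  assumes k: "1 \<le> k" "k * (k + 3) \<le> 2 * n + 2"
    and vw: "v \<in> increasing_words n k" "w \<in> increasing_words n k"
  shows "linked (increasing_words n k) v w"
proof (cases "k = 1")
  \<comment> \<open>Here \<open>1\<close> is the top letter and may occur many times, but there is
    only one word.\<close>
  case True
  have "x = replicate n 1" if "x \<in> increasing_words n k" for x
    using that True by (intro replicate_eqI) (auto simp: increasing_words_def increasing_def)
  then have "v = w"
    using vw by metis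
  then show ?thesis
    using vw linked_refl by blast
next
  case False
  then have k2: "2 \<le> k"
    using k by simp
  obtain v1 where v1: "linked (increasing_words n k) v v1" "length v1 = n" "staircase k k (mset v1)"
    using linked_staircase[OF k vw(1)] by blast
  obtain w1 where w1: "linked (increasing_words n k) w w1" "length w1 = n" "staircase k k (mset w1)"
    using linked_staircase[OF k vw(2)] by blast
  have eq: "mset v1 = mset w1"
    using staircase_unique v1 w1 by simp
  obtain v2 where v2: "linked (increasing_words n k) v1 v2" "mset v2 = mset v1"
      "\<forall>p<n. v2 ! p = 1 \<longleftrightarrow> p = 0"
    using linked_leading_one[OF k2 v1(3,2)] by blast
  obtain w2 where w2: "linked (increasing_words n k) w1 w2" "mset w2 = mset w1"
      "\<forall>p<n. w2 ! p = 1 \<longleftrightarrow> p = 0"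
    using linked_leading_one[OF k2 w1(3,2)] by blast
  have "length v2 = n"
    using v1 v2 by (metis size_mset)
  then have "linked (increasing_words n k) v2 w2"
    using v1 v2 w2 eq k2 by (intro linked_if_same_ones) auto
  then show ?thesis
    using v1 v2 w1 w2 by (meson linked.sym linked.trans)
qed

section \<open>Existence of a word\<close>

lemma increasing_words_nonempty:
  assumes "1 \<le> k" "k * (k + 3) \<le> 2 * n + 2"
  shows "increasing_words n k \<noteq> {}"
proof -
  define t where "t = (\<Sum>i<k. i)"
  have t: "2 * t + k = k * k"
    unfolding t_def by (induction k) auto
  \<comment> \<open>The counts are \<open>1, ..., k - 1\<close>, and all remaining letters are
    \<open>k\<close>. As \<open>t\<close> is \<open>k(k - 1)/2\<close>, the bound on
    \<open>n\<close> leaves at least \<open>k\<close> of them.\<close>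
  define M where "M = (\<Sum>i<k. replicate_mset i i) + replicate_mset (n - t) k"
  have c: "count M i = (if i < k then i else if i = k then n - t else 0)" for i
    by (simp add: M_def count_sum sum.delta)
  have "t + k \<le> n"
    using t assms by (simp add: algebra_simps)
  then have "size M = n"
    by (simp add: M_def size_multiset_sum t_def)
  moreover have "increasing k M"
    unfolding increasing_def
  proof (intro conjI allI impI subsetI)
    fix x assume "x \<in># M"
    then have "count M x \<noteq> 0"
      by simp
    then show "x \<in> {1..k}"
      using c[of x] assms by (auto split: if_splits)
  next
    fix j assume "j < k"
    then show "count M j < count M (Suc j)"
      using \<open>t + k \<le> n\<close> by (auto simp: c)
  qed
  moreover obtain w where "mset w = M"
    using ex_mset by blast
  ultimately show ?thesis
    by (auto simp: increasing_words_def)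
qed

section \<open>Functions and their strings\<close>

lemma strict_mono_on_atLeastAtMost_Suc_iff:
  fixes c :: "nat \<Rightarrow> nat"
  shows "strict_mono_on {m..k} c \<longleftrightarrow> (\<forall>j. m \<le> j \<and> j < k \<longrightarrow> c j < c (Suc j))"
proof
  assume "strict_mono_on {m..k} c"
  then show "\<forall>j. m \<le> j \<and> j < k \<longrightarrow> c j < c (Suc j)"
    by (auto simp: strict_mono_on_def)
next
  assume step: "\<forall>j. m \<le> j \<and> j < k \<longrightarrow> c j < c (Suc j)"
  have "c r < c s" if "Suc r \<le> s" "m \<le> r" "s \<le> k" for r s
    using that
  proof (induction s rule: dec_induct)
    case base
    then show ?case
      using step by simp
  next
    case (step s)
    then show ?case
      using \<open>\<forall>j. m \<le> j \<and> j < k \<longrightarrow> c j < c (Suc j)\<close>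
      by (metis Suc_leD Suc_le_lessD le_trans less_trans)
  qed
  then show "strict_mono_on {m..k} c"
    by (auto simp: strict_mono_on_def)
qed

lemma preimage_card_eq_count: "preimage_card n f j = count (mset (string_of n f)) j"
proof -
  have "mset (string_of n f) = image_mset f (mset_set {1..n})"
    by (simp add: string_of_def atLeastLessThanSuc_atLeastAtMost del: upt_Suc)
  then show ?thesis
    by (simp add: preimage_card_def count_image_mset Int_commute)
qed

text \<open>Counts that increase from \<open>count M 0 = 0\<close> are positive, so the comparison
  at \<open>j = 0\<close> encodes surjectivity.\<close>

lemma increasing_iff:
  assumes "1 \<le> k"
  shows "increasing k M \<longleftrightarrow> set_mset M = {1..k} \<and> strict_mono_on {1..k} (count M)"
proof
  assume M: "increasing k M"
  have "x \<in># M" if "x \<in> {1..k}" for x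
    using M that unfolding increasing_def
    by (cases x) (auto simp: Suc_le_eq intro!: count_inI)
  then show "set_mset M = {1..k} \<and> strict_mono_on {1..k} (count M)"
    using M by (auto simp: increasing_def strict_mono_on_atLeastAtMost_Suc_iff)
next
  assume M: "set_mset M = {1..k} \<and> strict_mono_on {1..k} (count M)"
  then have "count M 0 = 0" "0 < count M 1"
    using assms by (auto simp: count_eq_zero_iff)
  moreover have "count M j < count M (Suc j)" if "1 \<le> j" "j < k" for j
    using M that by (simp add: strict_mono_on_atLeastAtMost_Suc_iff)
  ultimately have "count M j < count M (Suc j)" if "j < k" for j
    using that by (cases j) auto
  then show "increasing k M"
    using M by (simp add: increasing_def)
qed

lemma string_of_increasing_onto:
  assumes "1 \<le> k"
  shows "string_of n ` increasing_onto n k = increasing_words n k"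
proof (intro equalityI subsetI)
  have set: "set (string_of n f) = f ` {1..n}" for f
    by (simp add: string_of_def atLeastLessThanSuc_atLeastAtMost del: upt_Suc)
  have pc: "preimage_card n f = count (mset (string_of n f))" for f
    by (rule ext) (rule preimage_card_eq_count)
  {
    fix w assume "w \<in> string_of n ` increasing_onto n k"
    then obtain f where "w = string_of n f" "f \<in> increasing_onto n k"
      by blast
    then show "w \<in> increasing_words n k"
      using assms
      by (simp add: increasing_words_def increasing_iff increasing_onto_def set pc del: count_mset)
        (simp add: string_of_def)
  next
    fix w assume w: "w \<in> increasing_words n k"
    \<comment> \<open>Arguments start at \<open>1\<close> and list positions at \<open>0\<close>;
      the restriction makes \<open>f\<close> extensional.\<close>
    define f where "f = restrict (\<lambda>i. w ! (i - 1)) {1..n}"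
    have len: "length w = n"
      using w by (rule length_increasing_words)
    have wf: "string_of n f = w"
      using len by (intro nth_equalityI) (auto simp: string_of_def f_def nth_append simp del: upt_Suc)
    have "f ` {1..n} = {1..k}" "strict_mono_on {1..k} (preimage_card n f)"
      using w assms set[of f] by (auto simp: pc wf increasing_words_def increasing_iff simp del: count_mset)
    moreover have "f \<in> extensional {1..n}"
      by (simp add: f_def)
    ultimately have "f \<in> increasing_onto n k"
      by (auto simp: increasing_onto_def PiE_def)
    with wf show "w \<in> string_of n ` increasing_onto n k"
      by blast
  }
qed

theorem theorem1:
  fixes k n :: nat
  assumes "k \<ge> 1" and "n \<ge> 1"
    and "real n \<ge> (real k + 4) * (real k - 1) / 2 + 1"
  shows "\<exists>a. is_ucycle n k (string_of n ` increasing_onto n k) a"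
proof -
  \<comment> \<open>Doubling the bound works because
    \<open>(k + 4)(k - 1) + 2 = k(k + 3) - 2\<close>.\<close>
  have "real (k * (k + 3)) \<le> real (2 * n + 2)"
    using assms(3) by (simp add: field_simps)
  then have slack: "k * (k + 3) \<le> 2 * n + 2"
    by (simp only: of_nat_le_iff)
  have "increasing_words n k \<subseteq> strings n k"
    by (auto simp: increasing_words_def increasing_def strings_def)
  then have "\<exists>a. is_ucycle n k (increasing_words n k) a"
    using increasing_words_nonempty[OF assms(1) slack] assms(2) rotate1_increasing_words
      linked_increasing_words[OF assms(1) slack]
    by (rule ucycle_if_linked)
  then show ?thesis
    by (simp only: string_of_increasing_onto[OF assms(1)])
qed

end
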